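(* Let $k\ge 1$ be an integer, let $G=(V,E,w)$ be a weighted graph, let $S\subseteq V$, let $\delta(S)$ be the corresponding cut set, and let $e\in\delta(S)$ be an edge with $w(e)<0$. If \[-w(e)\ \ge\ \sum_{e'\in\delta(S)\setminus\{e\}}|w(e')|,\] then contracting $e$ is an optimality-preserving data reduction for Max $k$-Cut. That is, let $G/e$ be the weighted graph obtained by contracting $e$; for every optimum Max $k$-Cut solution $q$ for $G/e$, the $k$-partition $p$ of $V$ that assigns to both endpoints of $e$ the colour $q$ gives to the contracted vertex, and that agrees with $q$ on all other vertices, is an optimum Max $k$-Cut solution for $G$.
   Context: A weighted graph $G=(V,E,w)$ is a finite simple undirected graph with edge weights $w:E\to\mathbb{R}$ (possibly negative). For $S\subseteq V$, $\delta(S)=\{\{s,t\}\in E : s\in S,\ t\notin S\}$. A $k$-partition of $V$ is a function $p:V\to\{1,\dots,k\}$ ($p(v)$ is the colour of $v$); its weight $w(p)$ is the sum of the weights of all edges whose endpoints have different colours; an optimum Max $k$-Cut solution is a $k$-partition of maximum weight. Contracting $e=\{u,v\}$ means identifying $u$ and $v$ to a single vertex, deleting the resulting loop, and replacing parallel edges by a single edge whose weight is the sum of their weights. A data transformation turns a weighted graph $G$ into a weighted graph $G'$ and provides a reconstruction that maps any $k$-partition of $V(G')$ to a $k$-partition of $V(G)$. It is a data reduction if $|V(G')|<|V(G)|$, or $|V(G')|=|V(G)|$ and $|E(G')|<|E(G)|$. It is optimality-preserving if the reconstruction maps every optimum solution for $G'$ to an optimum solution for $G$. *)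

theory Defs
  imports Complex_Main "HOL-Library.FuncSet"
begin

text \<open>
  Edges are two-element vertex sets. The field \<open>weight\<close> is total because functions are;
  only its values on \<open>edges G\<close> matter.
\<close>

record 'a wgraph =
  verts :: "'a set"
  edges :: "'a set set"
  weight :: "'a set \<Rightarrow> real"

definition weighted_graph :: "'a wgraph \<Rightarrow> bool" where
  "weighted_graph G \<longleftrightarrow>
     finite (verts G) \<and>
     (\<forall>e \<in> edges G. \<exists>u v. u \<in> verts G \<and> v \<in> verts G \<and> u \<noteq> v \<and> e = {u, v})"

definition cut_set :: "'a wgraph \<Rightarrow> 'a set \<Rightarrow> 'a set set" where
  "cut_set G S = {e \<in> edges G. \<exists>s t. e = {s, t} \<and> s \<in> S \<and> t \<notin> S}"

text \<open>
  Functions from the vertex set to the colours are taken extensionally, so that distinct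
  elements of \<open>k_partitions k V\<close> are distinct colourings of \<open>V\<close>.
\<close>

definition k_partitions :: "nat \<Rightarrow> 'a set \<Rightarrow> ('a \<Rightarrow> nat) set" where
  "k_partitions k V = V \<rightarrow>\<^sub>E {1..k}"

definition cut_weight :: "'a wgraph \<Rightarrow> ('a \<Rightarrow> nat) \<Rightarrow> real" where
  "cut_weight G p = (\<Sum>e \<in> {e \<in> edges G. \<exists>u v. e = {u, v} \<and> p u \<noteq> p v}. weight G e)"

definition optimum_max_k_cut :: "nat \<Rightarrow> 'a wgraph \<Rightarrow> ('a \<Rightarrow> nat) \<Rightarrow> bool" where
  "optimum_max_k_cut k G p \<longleftrightarrow>
     p \<in> k_partitions k (verts G) \<and>
     (\<forall>p' \<in> k_partitions k (verts G). cut_weight G p' \<le> cut_weight G p)"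

text \<open>
  The vertices of the contracted graph are the classes of the partition of the vertex set
  that identifies the endpoints of \<open>e\<close>: the contracted vertex is the set \<open>e\<close> itself, and any
  other vertex \<open>v\<close> becomes \<open>{v}\<close>. In a simple graph \<open>e\<close> is the only edge that becomes a loop.
  Edges with the same image are parallel, and their weights are added up.
\<close>

definition contract_vertex :: "'a set \<Rightarrow> 'a \<Rightarrow> 'a set" where
  "contract_vertex e v = (if v \<in> e then e else {v})"

definition contract :: "'a wgraph \<Rightarrow> 'a set \<Rightarrow> 'a set wgraph" where
  "contract G e =
     \<lparr>verts = contract_vertex e ` verts G,
      edges = (\<lambda>f. contract_vertex e ` f) ` (edges G - {e}),
      weight = (\<lambda>f'. \<Sum>f \<in> {f \<in> edges G - {e}. contract_vertex e ` f = f'}. weight G f)\<rparr>"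

definition uncontract_partition :: "'a wgraph \<Rightarrow> 'a set \<Rightarrow> ('a set \<Rightarrow> nat) \<Rightarrow> 'a \<Rightarrow> nat" where
  "uncontract_partition G e q = (\<lambda>v \<in> verts G. if v \<in> e then q e else q {v})"

text \<open>
  In the following three predicates \<open>G'\<close> is the transformed graph and \<open>r\<close> the reconstruction.
\<close>

definition data_transformation ::
    "nat \<Rightarrow> 'a wgraph \<Rightarrow> 'b wgraph \<Rightarrow> (('b \<Rightarrow> nat) \<Rightarrow> 'a \<Rightarrow> nat) \<Rightarrow> bool" where
  "data_transformation k G G' r \<longleftrightarrow>
     weighted_graph G \<and> weighted_graph G' \<and>
     (\<forall>q \<in> k_partitions k (verts G'). r q \<in> k_partitions k (verts G))"

definition data_reduction ::
    "nat \<Rightarrow> 'a wgraph \<Rightarrow> 'b wgraph \<Rightarrow> (('b \<Rightarrow> nat) \<Rightarrow> 'a \<Rightarrow> nat) \<Rightarrow> bool" where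
  "data_reduction k G G' r \<longleftrightarrow>
     data_transformation k G G' r \<and>
     (card (verts G') < card (verts G) \<or>
      card (verts G') = card (verts G) \<and> card (edges G') < card (edges G))"

definition optimality_preserving ::
    "nat \<Rightarrow> 'a wgraph \<Rightarrow> 'b wgraph \<Rightarrow> (('b \<Rightarrow> nat) \<Rightarrow> 'a \<Rightarrow> nat) \<Rightarrow> bool" where
  "optimality_preserving k G G' r \<longleftrightarrow>
     (\<forall>q. optimum_max_k_cut k G' q \<longrightarrow> optimum_max_k_cut k G (r q))"

end

theory Submission
  imports Defs "HOL-Combinatorics.Transposition"
begin

text \<open>
  If a colouring gives the endpoints of \<open>e\<close> distinct colours \<open>a\<close> and \<open>b\<close>, exchange \<open>a\<close> and \<open>b\<close>
  on \<open>S\<close>. Only edges of the cut set of \<open>S\<close> can change between cut and uncut, and \<open>e\<close> becomes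
  uncut, so the weight changes by at least \<open>- w(e)\<close> minus the sum of \<open>\<bar>w(e')\<bar>\<close> over the other
  edges \<open>e'\<close> of the cut set, which is nonnegative. Hence no colouring of \<open>G\<close> beats the best one
  that is constant on \<open>e\<close>, and the colourings constant on \<open>e\<close> are the colourings of the
  contracted graph, with the same weights.
\<close>

text \<open>This names the condition inlined in \<open>cut_weight\<close>, so that it can be
  simplified on an explicit pair.\<close>

definition separated :: "('a \<Rightarrow> 'c) \<Rightarrow> 'a set \<Rightarrow> bool" where
  "separated p f \<longleftrightarrow> (\<exists>u v. f = {u, v} \<and> p u \<noteq> p v)"

lemma separated_doubleton [simp]: "separated p {u, v} \<longleftrightarrow> p u \<noteq> p v"
  unfolding separated_def doubleton_eq_iff by metis

lemma edgeE:
  assumes "weighted_graph G" "f \<in> edges G"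
  obtains u v where "f = {u, v}" "u \<in> verts G" "v \<in> verts G" "u \<noteq> v"
  using assms unfolding weighted_graph_def by blast

lemma finite_verts: "weighted_graph G \<Longrightarrow> finite (verts G)"
  by (simp add: weighted_graph_def)

lemma finite_edges:
  assumes "weighted_graph G"
  shows "finite (edges G)"
proof (rule finite_subset)
  show "edges G \<subseteq> Pow (verts G)"
    using assms by (auto elim: edgeE)
  show "finite (Pow (verts G))"
    using finite_verts[OF assms] by simp
qed

text \<open>Moving the condition into the summand gives all colourings the same index set, so that
  two cut weights can be compared edge by edge.\<close>

lemma cut_weight_conv_sum:
  assumes "weighted_graph G"
  shows "cut_weight G p = (\<Sum>f\<in>edges G. if separated p f then weight G f else 0)"
  unfolding cut_weight_def separated_def[symmetric]
  using finite_edges[OF assms] by (simp add: sum.inter_filter)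

lemma swap_colours_improves:
  assumes G: "weighted_graph G"
    and S: "S \<subseteq> verts G"
    and e: "{s, t} \<in> edges G" "s \<in> S" "t \<notin> S"
    and dom: "- weight G {s, t} \<ge> (\<Sum>e' \<in> cut_set G S - {{s, t}}. \<bar>weight G e'\<bar>)"
    and p: "p \<in> k_partitions k (verts G)"
  shows "\<exists>p' \<in> k_partitions k (verts G). p' s = p' t \<and> cut_weight G p \<le> cut_weight G p'"
proof (cases "p s = p t")
  case True
  then show ?thesis using p by blast
next
  case False
  \<comment> \<open>Both exchanged colours lie in \<open>{1..k}\<close>, because \<open>s\<close>
    and \<open>t\<close> are vertices; hence \<open>\<tau>\<close> maps \<open>{1..k}\<close> to
    itself.\<close>
  define \<tau> where "\<tau> = transpose (p s) (p t)"
  define p' where "p' x = (if x \<in> S then \<tau> (p x) else p x)" for x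
  have st: "s \<in> verts G" "t \<in> verts G"
    using edgeE[OF G e(1)] by (metis doubleton_eq_iff)+
  have mono: "p' s = p' t"
    using e by (simp add: p'_def \<tau>_def)
  have range: "p x \<in> {1..k}" if "x \<in> verts G" for x
    using p that by (auto simp: k_partitions_def PiE_def Pi_def)
  have p': "p' \<in> k_partitions k (verts G)"
    unfolding k_partitions_def
  proof (rule PiE_I)
    fix x assume "x \<in> verts G"
    then show "p' x \<in> {1..k}"
      using range[of x] range[OF st(1)] range[OF st(2)]
      by (auto simp: p'_def \<tau>_def transpose_def)
  next
    fix x assume "x \<notin> verts G"
    \<comment> \<open>Extensionality survives: since \<open>S\<close> contains only vertices, the
      value \<open>undefined\<close> is never sent through \<open>\<tau>\<close>.\<close>
    moreover from this have "x \<notin> S" using S by blast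
    ultimately show "p' x = undefined"
      using p PiE_arb[of p "verts G" "\<lambda>_. {1..k}" x] by (simp add: p'_def k_partitions_def)
  qed
  let ?E = "edges G" and ?C = "cut_set G S"
  let ?d = "\<lambda>f. (if separated p' f then weight G f else 0) - (if separated p f then weight G f else 0)"
  have C: "?C \<subseteq> ?E" "{s, t} \<in> ?C"
    using e by (auto simp: cut_set_def)
  have finE: "finite ?E" using finite_edges[OF G] .
  have unchanged: "?d f = 0" if f_mem: "f \<in> ?E - ?C" for f
  proof -
    obtain u v where f: "f = {u, v}" using f_mem edgeE[OF G] by blast
    \<comment> \<open>Both ends lie on the same side of \<open>S\<close>, so either
      \<open>\<tau>\<close>, which is injective, acts on both colours or neither colour
      changes.\<close>
    have "u \<in> S \<longleftrightarrow> v \<in> S"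
      using f_mem unfolding f cut_set_def by (auto simp: insert_commute)
    then have "p' u = p' v \<longleftrightarrow> p u = p v"
      unfolding p'_def \<tau>_def by (metis transpose_involutory)
    then show ?thesis by (simp add: f)
  qed
  have "cut_weight G p' - cut_weight G p = sum ?d ?E"
    by (simp add: cut_weight_conv_sum[OF G] sum_subtractf)
  also have "\<dots> = sum ?d ?C"
    using unchanged C(1) finE by (intro sum.mono_neutral_right) auto
  also have "\<dots> = ?d {s, t} + sum ?d (?C - {{s, t}})"
    using C finE by (intro sum.remove) (auto intro: finite_subset)
  also have "\<dots> \<ge> - weight G {s, t} - (\<Sum>f \<in> ?C - {{s, t}}. \<bar>weight G f\<bar>)"
  proof -
    have "?d {s, t} = - weight G {s, t}"
      using mono False by simp
    \<comment> \<open>Each summand is \<open>0\<close>, \<open>weight G f\<close> or its negative,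
      hence at least minus the absolute value.\<close>
    moreover have "(\<Sum>f \<in> ?C - {{s, t}}. - \<bar>weight G f\<bar>) \<le> sum ?d (?C - {{s, t}})"
      by (intro sum_mono) auto
    ultimately show ?thesis by (simp add: sum_negf)
  qed
  finally have "cut_weight G p \<le> cut_weight G p'"
    using dom by linarith
  with p' mono show ?thesis by blast
qed

lemma verts_contract: "verts (contract G e) = contract_vertex e ` verts G"
  and edges_contract: "edges (contract G e) = (\<lambda>f. contract_vertex e ` f) ` (edges G - {e})"
  and weight_contract: "weight (contract G e) f' =
    (\<Sum>f \<in> {f \<in> edges G - {e}. contract_vertex e ` f = f'}. weight G f)"
  by (simp_all add: contract_def)

text \<open>A class \<open>{y}\<close> with \<open>y\<close> outside \<open>e\<close> differs from
  \<open>e\<close>, as it contains \<open>y\<close>. So the only vertices merged are those of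
  \<open>e\<close>.\<close>

lemma contract_vertex_eq_iff:
  assumes "e = {s, t}" "s \<noteq> t"
  shows "contract_vertex e x = contract_vertex e y \<longleftrightarrow> x = y \<or> x \<in> e \<and> y \<in> e"
  using assms by (auto simp: contract_vertex_def)

lemma weighted_graph_contract:
  assumes G: "weighted_graph G" and e: "e \<in> edges G"
  shows "weighted_graph (contract G e)"
proof -
  obtain s t where st: "e = {s, t}" "s \<noteq> t" using edgeE[OF G e] by metis
  have "\<exists>a b. a \<in> contract_vertex e ` verts G \<and> b \<in> contract_vertex e ` verts G \<and> a \<noteq> b \<and>
      contract_vertex e ` f = {a, b}" if f_mem: "f \<in> edges G" "f \<noteq> e" for f
  proof -
    obtain u v where f: "f = {u, v}" "u \<in> verts G" "v \<in> verts G" "u \<noteq> v"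
      using edgeE[OF G f_mem(1)] by metis
    \<comment> \<open>An edge with both ends in the two-element set \<open>e\<close> would be
      \<open>e\<close> itself, so no other edge becomes a loop.\<close>
    have "\<not> (u \<in> e \<and> v \<in> e)" using f f_mem(2) st by auto
    then have "contract_vertex e u \<noteq> contract_vertex e v"
      using f(4) by (simp add: contract_vertex_eq_iff[OF st])
    then show ?thesis using f by (intro exI conjI) auto
  qed
  then show ?thesis
    using finite_verts[OF G] by (simp add: weighted_graph_def verts_contract edges_contract)
qed

text \<open>The endpoints of \<open>e\<close> collide, so \<open>contract_vertex e\<close> is not
  injective on the finite vertex set. This gives the first alternative in
  \<open>data_reduction\<close>.\<close>

lemma card_verts_contract_less:
  assumes G: "weighted_graph G" and e: "e \<in> edges G"
  shows "card (verts (contract G e)) < card (verts G)"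
proof -
  obtain s t where st: "e = {s, t}" "s \<in> verts G" "t \<in> verts G" "s \<noteq> t"
    using edgeE[OF G e] by metis
  have "contract_vertex e s = contract_vertex e t"
    by (simp add: st(1) contract_vertex_def)
  then have "\<not> inj_on (contract_vertex e) (verts G)"
    using st(2-4) unfolding inj_on_def by blast
  then have "card (contract_vertex e ` verts G) \<noteq> card (verts G)"
    using eq_card_imp_inj_on[OF finite_verts[OF G]] by blast
  then show ?thesis
    using card_image_le[OF finite_verts[OF G], of "contract_vertex e"]
    by (simp add: verts_contract)
qed

text \<open>On vertices the reconstruction is the pullback along \<open>contract_vertex e\<close>,
  which avoids the case split from here on.\<close>

lemma uncontract_partition_apply:
  "x \<in> verts G \<Longrightarrow> uncontract_partition G e q x = q (contract_vertex e x)"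
  by (simp add: uncontract_partition_def contract_vertex_def)

lemma uncontract_partition_in_k_partitions:
  assumes "q \<in> k_partitions k (verts (contract G e))"
  shows "uncontract_partition G e q \<in> k_partitions k (verts G)"
  unfolding k_partitions_def
proof (rule PiE_I)
  fix x assume "x \<in> verts G"
  then show "uncontract_partition G e q x \<in> {1..k}"
    using assms PiE_mem[of q "contract_vertex e ` verts G" "\<lambda>_. {1..k}" "contract_vertex e x"]
    by (simp add: uncontract_partition_apply k_partitions_def verts_contract)
qed (simp add: uncontract_partition_def)

text \<open>Grouping the edges of \<open>G\<close> other than \<open>e\<close> by their image turns
  each class of parallel edges into one summand.\<close>

lemma cut_weight_contract:
  assumes G: "weighted_graph G" and e: "e \<in> edges G"
  shows "cut_weight (contract G e) q = cut_weight G (uncontract_partition G e q)"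
proof -
  obtain s t where st: "e = {s, t}" "s \<in> verts G" "t \<in> verts G"
    using edgeE[OF G e] by metis
  let ?p = "uncontract_partition G e q" and ?c = "\<lambda>f. contract_vertex e ` f"
  have sep: "separated ?p f \<longleftrightarrow> separated q (?c f)" if f_mem: "f \<in> edges G" for f
  proof -
    obtain u v where "f = {u, v}" "u \<in> verts G" "v \<in> verts G"
      using edgeE[OF G f_mem] by metis
    then show ?thesis by (simp add: uncontract_partition_apply)
  qed
  have fin: "finite (edges G - {e})" using finite_edges[OF G] by simp
  have "cut_weight (contract G e) q =
      (\<Sum>f'\<in>?c ` (edges G - {e}). if separated q f' then weight (contract G e) f' else 0)"
    by (simp add: cut_weight_conv_sum[OF weighted_graph_contract[OF G e]] edges_contract)
  \<comment> \<open>Whether \<open>q\<close> separates an edge depends only on its image, so the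
    condition is constant on each class and moves into the inner sum.\<close>
  also have "\<dots> = (\<Sum>f'\<in>?c ` (edges G - {e}). \<Sum>f\<in>{f \<in> edges G - {e}. ?c f = f'}.
      if separated q (?c f) then weight G f else 0)"
    by (intro sum.cong refl) (simp add: weight_contract)
  also have "\<dots> = (\<Sum>f\<in>edges G - {e}. if separated q (?c f) then weight G f else 0)"
    by (rule sum.image_gen[OF fin, symmetric])
  also have "\<dots> = (\<Sum>f\<in>edges G - {e}. if separated ?p f then weight G f else 0)"
    by (intro sum.cong refl) (simp add: sep)
  also have "\<dots> = (\<Sum>f\<in>edges G. if separated ?p f then weight G f else 0)"
  proof -
    \<comment> \<open>Both ends of \<open>e\<close> get the colour of the contracted vertex, so
      putting the deleted edge back adds zero.\<close>
    have "\<not> separated ?p e"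
      using st by (simp add: uncontract_partition_apply contract_vertex_def)
    then show ?thesis
      by (simp add: sum.remove[OF finite_edges[OF G] e])
  qed
  finally show ?thesis by (simp add: cut_weight_conv_sum[OF G])
qed

text \<open>A colouring that agrees on \<open>s\<close> and \<open>t\<close> is constant on the
  fibres of \<open>contract_vertex e\<close>, so it factors through the contraction.\<close>

lemma uncontract_partition_surj:
  assumes p: "p \<in> k_partitions k (verts G)" and e: "e = {s, t}" "s \<noteq> t"
    and eq: "p s = p t"
  obtains q where "q \<in> k_partitions k (verts (contract G e))" "uncontract_partition G e q = p"
proof
  \<comment> \<open>\<open>inv_into\<close> picks some representative of the class \<open>X\<close>;
    any choice gives the same colour.\<close>
  define q where "q = (\<lambda>X \<in> verts (contract G e). p (inv_into (verts G) (contract_vertex e) X))"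
  have q: "q (contract_vertex e x) = p x" if "x \<in> verts G" for x
  proof -
    let ?y = "inv_into (verts G) (contract_vertex e) (contract_vertex e x)"
    have "contract_vertex e ?y = contract_vertex e x"
      using that by (intro f_inv_into_f imageI)
    then have "p ?y = p x"
      using eq unfolding contract_vertex_eq_iff[OF e] by (auto simp: e(1))
    then show ?thesis using that by (simp add: q_def verts_contract)
  qed
  show "q \<in> k_partitions k (verts (contract G e))"
    unfolding k_partitions_def
  proof (rule PiE_I)
    fix X assume "X \<in> verts (contract G e)"
    then obtain x where "x \<in> verts G" "X = contract_vertex e x"
      unfolding verts_contract by blast
    then show "q X \<in> {1..k}"
      using q p PiE_mem[of p "verts G" "\<lambda>_. {1..k}" x] by (simp add: k_partitions_def)
  qed (simp add: q_def)
  show "uncontract_partition G e q = p"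
  proof
    fix x show "uncontract_partition G e q x = p x"
    proof (cases "x \<in> verts G")
      case True
      then show ?thesis by (simp add: uncontract_partition_apply q)
    next
      case False
      then show ?thesis
        using p PiE_arb[of p "verts G" "\<lambda>_. {1..k}" x]
        by (simp add: uncontract_partition_def k_partitions_def)
    qed
  qed
qed

theorem theorem12:
  fixes k :: nat and G :: "'a wgraph" and S :: "'a set" and e :: "'a set"
  assumes "k \<ge> 1"
    and "weighted_graph G"
    and "S \<subseteq> verts G"
    and "e \<in> cut_set G S"
    and "weight G e < 0"
    and "- weight G e \<ge> (\<Sum>e' \<in> cut_set G S - {e}. \<bar>weight G e'\<bar>)"
  shows "data_reduction k G (contract G e) (uncontract_partition G e) \<and>
    optimality_preserving k G (contract G e) (uncontract_partition G e)"
proof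
  note G = assms(2)
  obtain s t where st: "e = {s, t}" "s \<in> S" "t \<notin> S" and e: "e \<in> edges G"
    using assms(4) unfolding cut_set_def by blast
  have "s \<noteq> t" using st by blast
  show "data_reduction k G (contract G e) (uncontract_partition G e)"
    unfolding data_reduction_def data_transformation_def
    using G weighted_graph_contract[OF G e] card_verts_contract_less[OF G e]
      uncontract_partition_in_k_partitions by blast
  show "optimality_preserving k G (contract G e) (uncontract_partition G e)"
    unfolding optimality_preserving_def
  proof (intro allI impI)
    fix q assume q: "optimum_max_k_cut k (contract G e) q"
    show "optimum_max_k_cut k G (uncontract_partition G e q)"
      unfolding optimum_max_k_cut_def
    proof (intro conjI ballI)
      show "uncontract_partition G e q \<in> k_partitions k (verts G)"
        using q by (simp add: optimum_max_k_cut_def uncontract_partition_in_k_partitions)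
      fix p assume p: "p \<in> k_partitions k (verts G)"
      obtain p' where p': "p' \<in> k_partitions k (verts G)" "p' s = p' t"
        and le: "cut_weight G p \<le> cut_weight G p'"
        using swap_colours_improves[OF G assms(3) _ st(2,3) _ p] e assms(6)
        unfolding st(1) by blast
      \<comment> \<open>Optimality of \<open>q\<close> speaks only of colourings of the contracted
        graph, so \<open>p'\<close> is first written as the pullback of such a colouring.\<close>
      obtain q' where q': "q' \<in> k_partitions k (verts (contract G e))"
        "uncontract_partition G e q' = p'"
        using uncontract_partition_surj[OF p'(1) st(1) \<open>s \<noteq> t\<close> p'(2)] by blast
      have "cut_weight G p' = cut_weight (contract G e) q'"
        using q'(2) by (simp add: cut_weight_contract[OF G e])
      also have "\<dots> \<le> cut_weight (contract G e) q"
        using q q'(1) by (simp add: optimum_max_k_cut_def)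
      also have "\<dots> = cut_weight G (uncontract_partition G e q)"
        by (rule cut_weight_contract[OF G e])
      finally show "cut_weight G p \<le> cut_weight G (uncontract_partition G e q)"
        using le by simp
    qed
  qed
qed

end
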